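(* Let $n\ge 2$ be an integer, and let $q$ and $p$ be the smallest and the largest prime divisor of $n$, respectively. Then $$\frac{q}{p+1}\,\frac{1}{\varphi(n)}\sum_{a\in\mathbb{Z}_n^*}\gcd(a-1,n)^2\;\le\;\sigma(n)\;\le\;\frac{1}{\varphi(n)}\sum_{a\in\mathbb{Z}_n^*}\gcd(a-1,n)^2,$$ where $\sigma(n)$ is the sum of the (positive) divisors of $n$.
   Context: $\mathbb{Z}_n^*=\{a\in\mathbb{N} : 1\le a\le n,\ \gcd(a,n)=1\}$ is the group of units modulo $n$, with the convention $\gcd(0,n)=n$, and $\varphi$ is Euler's totient function. *)

theory Defs
  imports Complex_Main "HOL-Number_Theory.Number_Theory"
begin

definition divisor_sum :: "nat \<Rightarrow> nat" where
  "divisor_sum n = (\<Sum>d | d dvd n. d)"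

end

theory Submission
  imports Defs
begin

text \<open>
  The averaged sum has a closed form: it equals \<open>\<Sum>d | d dvd n. \<psi> d\<close>, where
  \<open>\<psi> d = d * (\<Prod>r. 1 + 1 / r)\<close>, the product being over the prime divisors of \<open>d\<close>, is Dedekind's
  psi function (\<open>sum_gcd_square_totatives\<close>). Indeed \<open>m\<^sup>2\<close> is the sum of Jordan's totient \<open>J\<^sub>2\<close> over the
  divisors of \<open>m\<close> (\<open>sum_jordan2_divisors\<close>). Inserting this for \<open>m = gcd (a - 1) n\<close> and exchanging
  the sums, every divisor \<open>d\<close> of \<open>n\<close> contributes \<open>J\<^sub>2 d\<close> times the number of units modulo \<open>n\<close>
  that are congruent to 1 modulo \<open>d\<close>. That number is \<open>\<phi> n / \<phi> d\<close>
  (\<open>totient_eq_mult_card_cong_1\<close>), and \<open>J\<^sub>2 d / \<phi> d = \<psi> d\<close>.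

  It remains to compare \<open>\<psi> d\<close> with \<open>d\<close>, one divisor at a time. Clearly \<open>d \<le> \<psi> d\<close>. The prime
  divisors of \<open>d\<close> lie between \<open>q\<close> and \<open>p\<close>, so that \<open>\<psi> d / d\<close> is at most the product of
  \<open>1 + 1 / k\<close> over all integers \<open>k\<close> from \<open>q\<close> to \<open>p\<close>, which telescopes to \<open>(p + 1) / q\<close>
  (\<open>dedekind_psi_le\<close>).
\<close>

section \<open>Units congruent to one modulo a divisor\<close>

text \<open>
  The number \<open>c = b + d * t\<close> is prime to \<open>n\<close> if every prime divisor \<open>r\<close> of \<open>n\<close> divides exactly
  one of the two summands.
  If \<open>r\<close> divides \<open>d\<close> or \<open>b\<close>, this holds as soon as \<open>t\<close> is prime to \<open>r\<close>; otherwise \<open>r\<close> has to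
  divide \<open>t\<close>. So \<open>t\<close> is the product of the primes of the latter kind.
\<close>
lemma coprime_lift_modulus:
  fixes b d n :: nat
  assumes "coprime b d" "n > 0"
  obtains c where "coprime c n" "[c = b] (mod d)"
proof -
  define T where "T = {r \<in> prime_factors n. \<not> r dvd d \<and> \<not> r dvd b}"
  have fin: "finite T"
    by (simp add: T_def)
  define c where "c = b + d * \<Prod>T"
  have "coprime c n"
  proof (rule ccontr)
    assume "\<not> coprime c n"
    then obtain r where r: "prime r" "r dvd c" "r dvd n"
      using prime_factor_nat[of "gcd c n"] by (metis coprime_iff_gcd_eq_1 gcd_dvd1 gcd_dvd2 dvd_trans)
    have T_iff: "r dvd \<Prod>T \<longleftrightarrow> r \<in> T"
    proof
      assume "r dvd \<Prod>T"
      then obtain s where "s \<in> T" "r dvd s"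
        using r(1) fin by (auto simp: prime_dvd_prod_iff)
      moreover from this have "prime s"
        by (auto simp: T_def)
      ultimately show "r \<in> T"
        using r(1) primes_dvd_imp_eq by blast
    qed (use fin in auto)
    have r_n: "r \<in> prime_factors n"
      using r assms by (simp add: prime_factors_dvd)
    have not_both: "\<not> (r dvd b \<and> r dvd d)"
      using assms(1) r(1) by (meson coprime_common_divisor not_prime_unit)
    show False
    proof (cases "r dvd b")
      case True
      hence "r dvd d * \<Prod>T"
        using r(2) by (simp add: c_def dvd_add_right_iff)
      with True not_both show False
        using T_iff r(1) by (auto simp: prime_dvd_mult_iff T_def)
    next
      case False
      hence "\<not> r dvd d * \<Prod>T"
        using r(2) dvd_add_left_iff unfolding c_def by blast
      with False show False
        using T_iff r_n by (auto simp: T_def)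
    qed
  qed
  moreover have "[c = b] (mod d)"
    by (simp add: c_def cong_def)
  ultimately show thesis
    by (rule that)
qed

text \<open>Multiplication by the unit \<open>c\<close> embeds one residue class of units into the other.\<close>
lemma card_totatives_cong_le:
  fixes b c d n :: nat
  assumes "n > 1" "d dvd n" "coprime c n"
  shows "card {a \<in> totatives n. [a = b] (mod d)} \<le> card {a \<in> totatives n. [a = c * b] (mod d)}"
proof (rule card_inj_on_le)
  show "inj_on (\<lambda>a. c * a mod n) {a \<in> totatives n. [a = b] (mod d)}"
  proof (rule inj_onI)
    fix x y
    assume *: "x \<in> {a \<in> totatives n. [a = b] (mod d)}" "y \<in> {a \<in> totatives n. [a = b] (mod d)}"
      "c * x mod n = c * y mod n"
    hence "[x = y] (mod n)"
      using assms(3) cong_mult_lcancel_nat cong_def by blast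
    thus "x = y"
      using * assms(1) by (auto simp: cong_def totatives_less)
  qed
  show "(\<lambda>a. c * a mod n) ` {a \<in> totatives n. [a = b] (mod d)}
          \<subseteq> {a \<in> totatives n. [a = c * b] (mod d)}"
  proof safe
    fix x
    assume x: "x \<in> totatives n" "[x = b] (mod d)"
    have cop: "coprime (c * x mod n) n"
      using x assms by (simp add: in_totatives_iff coprime_mod_left_iff)
    hence "c * x mod n \<noteq> 0"
      using assms(1) by (metis coprime_0_left_iff nat_dvd_1_iff_1 less_irrefl)
    with cop show "c * x mod n \<in> totatives n"
      using assms(1) by (simp add: in_totatives_iff less_imp_le)
    have "[c * x mod n = c * x] (mod d)"
      using assms(2) by (simp add: cong_def mod_mod_cancel)
    also have "[c * x = c * b] (mod d)"
      using x(2) by (rule cong_scalar_left)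
    finally show "[c * x mod n = c * b] (mod d)" .
  qed
qed simp

text \<open>
  Reduction \<open>\<int>\<^sub>n\<^sup>* \<rightarrow> \<int>\<^sub>d\<^sup>*\<close> is a homomorphism of groups, so its fibres are translates of each other:
  lift \<open>b\<close> to a unit \<open>c\<close> modulo \<open>n\<close> and multiply by \<open>c\<close> or by its inverse.
\<close>
lemma card_totatives_cong_eq:
  fixes b d n :: nat
  assumes "n > 1" "d dvd n" "coprime b d"
  shows "card {a \<in> totatives n. [a = b] (mod d)} = card {a \<in> totatives n. [a = 1] (mod d)}"
proof (rule antisym)
  obtain c where c: "coprime c n" "[c = b] (mod d)"
    using coprime_lift_modulus assms by (metis less_trans zero_less_one)
  obtain c' where c': "[c * c' = 1] (mod n)"
    using c(1) cong_solve_coprime_nat by auto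
  hence cop': "coprime c' n"
    by (metis cong_imp_coprime cong_sym coprime_1_left coprime_mult_left_iff)
  have "[c' * b = c' * c] (mod d)"
    using c(2) by (intro cong_scalar_left) (rule cong_sym)
  also have "[c' * c = 1] (mod d)"
    using c' assms(2) by (simp add: mult.commute cong_dvd_modulus_nat)
  finally have 1: "[a = c' * b] (mod d) \<longleftrightarrow> [a = 1] (mod d)" for a
    by (meson cong_sym cong_trans)
  have 2: "[a = c * 1] (mod d) \<longleftrightarrow> [a = b] (mod d)" for a
    using c(2) unfolding mult_1_right by (meson cong_sym cong_trans)
  show "card {a \<in> totatives n. [a = b] (mod d)} \<le> card {a \<in> totatives n. [a = 1] (mod d)}"
    using card_totatives_cong_le[OF assms(1,2) cop', of b] unfolding 1 .
  show "card {a \<in> totatives n. [a = 1] (mod d)} \<le> card {a \<in> totatives n. [a = b] (mod d)}"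
    using card_totatives_cong_le[OF assms(1,2) c(1), of 1] unfolding 2 .
qed

text \<open>
  The representatives in \<open>totatives d\<close> are \<open>1, \<dots>, d\<close>, so for \<open>d = 1\<close> the representative is 1 and
  not the remainder 0; hence the separate case here and in the next lemma.
\<close>
lemma ex_cong_totative:
  fixes a d :: nat
  assumes "coprime a d" "d > 0"
  shows "\<exists>b\<in>totatives d. [a = b] (mod d)"
proof (cases "d = 1")
  case False
  hence "a mod d \<noteq> 0"
    using assms by (metis coprime_absorb_right dvd_eq_mod_eq_0 nat_dvd_1_iff_1 is_unit_gcd gcd_nat.absorb2)
  thus ?thesis
    using assms by (intro bexI[of _ "a mod d"]) (auto simp: in_totatives_iff coprime_mod_left_iff less_imp_le cong_def)
qed (auto simp: cong_def)

lemma totatives_cong_imp_eq: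
  assumes "x \<in> totatives d" "y \<in> totatives d" "[x = y] (mod d)"
  shows "x = y"
proof (cases "d > 1")
  case True
  thus ?thesis
    using assms by (auto simp: cong_def totatives_less)
next
  case False
  thus ?thesis
    using assms by (auto simp: in_totatives_iff)
qed

text \<open>
  The reduction \<open>\<int>\<^sub>n\<^sup>* \<rightarrow> \<int>\<^sub>d\<^sup>*\<close> has \<open>\<phi> d\<close> fibres, all as large as its kernel.
\<close>
lemma totient_eq_mult_card_cong_1:
  fixes d n :: nat
  assumes "n > 1" "d dvd n"
  shows "totient n = totient d * card {a \<in> totatives n. [a = 1] (mod d)}"
proof -
  have d: "d > 0"
    using assms dvd_pos_nat[of n d] by auto
  have "totatives n = (\<Union>b\<in>totatives d. {a \<in> totatives n. [a = b] (mod d)})"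
  proof -
    have "\<exists>b\<in>totatives d. [a = b] (mod d)" if "a \<in> totatives n" for a
    proof (rule ex_cong_totative)
      show "coprime a d"
        using that assms(2) coprime_divisors[of a a d n] by (auto simp: in_totatives_iff)
    qed (use d in auto)
    thus ?thesis
      by blast
  qed
  hence "totient n = card (\<Union>b\<in>totatives d. {a \<in> totatives n. [a = b] (mod d)})"
    by (simp add: totient_def)
  also have "\<dots> = (\<Sum>b\<in>totatives d. card {a \<in> totatives n. [a = b] (mod d)})"
  proof (intro card_UN_disjoint ballI impI)
    fix b b'
    assume "b \<in> totatives d" "b' \<in> totatives d" "b \<noteq> b'"
    thus "{a \<in> totatives n. [a = b] (mod d)} \<inter> {a \<in> totatives n. [a = b'] (mod d)} = {}"
      using totatives_cong_imp_eq[of b d b'] cong_trans cong_sym by blast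
  qed auto
  also have "\<dots> = (\<Sum>b\<in>totatives d. card {a \<in> totatives n. [a = 1] (mod d)})"
    using assms by (intro sum.cong refl card_totatives_cong_eq) (auto simp: in_totatives_iff)
  finally show ?thesis
    by (simp add: totient_def)
qed

text \<open>
  The order of summation is exchanged: a divisor \<open>d\<close> of \<open>n\<close> divides \<open>gcd (a - 1) n\<close> exactly when
  \<open>a\<close> lies in the kernel of the reduction \<open>\<int>\<^sub>n\<^sup>* \<rightarrow> \<int>\<^sub>d\<^sup>*\<close>. Taking for \<open>g\<close> the totient function
  gives Menon's identity.
\<close>
lemma menon_sum:
  fixes g :: "nat \<Rightarrow> real" and n :: nat
  assumes "n > 1"
  shows "(\<Sum>a\<in>totatives n. \<Sum>d | d dvd gcd (a - 1) n. g d)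
           = real (totient n) * (\<Sum>d | d dvd n. g d / real (totient d))"
proof -
  have kernel: "d dvd a - 1 \<longleftrightarrow> [a = 1] (mod d)" if "a \<in> totatives n" for a d
    using that by (simp add: in_totatives_iff cong_altdef_nat)
  have "(\<Sum>a\<in>totatives n. \<Sum>d | d dvd gcd (a - 1) n. g d)
      = (\<Sum>a\<in>totatives n. \<Sum>d | d \<in> {d. d dvd n} \<and> [a = 1] (mod d). g d)"
    by (intro sum.cong refl) (auto simp: kernel simp del: One_nat_def)
  also have "\<dots> = (\<Sum>d | d dvd n. \<Sum>a | a \<in> totatives n \<and> [a = 1] (mod d). g d)"
    using assms by (intro sum.swap_restrict) auto
  also have "\<dots> = (\<Sum>d | d dvd n. real (totient n) * (g d / real (totient d)))"
  proof (intro sum.cong refl)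
    fix d
    assume "d \<in> {d. d dvd n}"
    hence d: "d dvd n" "d > 0"
      using assms dvd_pos_nat[of n d] by auto
    show "(\<Sum>a | a \<in> totatives n \<and> [a = 1] (mod d). g d)
            = real (totient n) * (g d / real (totient d))"
      using d by (subst totient_eq_mult_card_cong_1[OF assms d(1)]) simp
  qed
  finally show ?thesis
    by (simp add: sum_distrib_left)
qed

section \<open>Jordan's totient and Dedekind's psi function\<close>

definition jordan2 :: "nat \<Rightarrow> real" where
  "jordan2 n = real n ^ 2 * (\<Prod>r\<in>prime_factors n. 1 - 1 / real r ^ 2)"

definition dedekind_psi :: "nat \<Rightarrow> real" where
  "dedekind_psi n = real n * (\<Prod>r\<in>prime_factors n. 1 + 1 / real r)"

lemma jordan2_eq_psi_mult_totient: "jordan2 n = dedekind_psi n * real (totient n)"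
proof -
  have "(\<Prod>r\<in>prime_factors n. 1 - 1 / real r ^ 2)
      = (\<Prod>r\<in>prime_factors n. (1 + 1 / real r) * (1 - 1 / real r))"
    by (intro prod.cong refl) (simp add: algebra_simps power2_eq_square)
  thus ?thesis
    by (simp add: jordan2_def dedekind_psi_def totient_formula2 prod.distrib power2_eq_square)
qed

lemma jordan2_prime_power_mult:
  fixes p d k :: nat
  assumes "prime p" "\<not> p dvd d"
  shows "jordan2 (p ^ Suc k * d) = (real p ^ 2) ^ k * (real p ^ 2 - 1) * jordan2 d"
proof -
  have d: "d \<noteq> 0"
    using assms(2) by (metis dvd_0_right)
  have p: "p \<noteq> 0"
    using assms by auto
  have "prime_factors (p ^ Suc k * d) = prime_factors (p ^ Suc k) \<union> prime_factors d"
    using d p by (subst prime_factorization_mult) auto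
  also have "prime_factors (p ^ Suc k) = {p}"
    using assms(1) by (subst prime_factors_power) (auto simp: prime_factorization_prime)
  finally have "prime_factors (p ^ Suc k * d) = insert p (prime_factors d)"
    by simp
  moreover have "p \<notin> prime_factors d"
    using assms(2) by auto
  ultimately have "jordan2 (p ^ Suc k * d) = (real p ^ Suc k * real d) ^ 2 *
      ((1 - 1 / real p ^ 2) * (\<Prod>r\<in>prime_factors d. 1 - 1 / real r ^ 2))"
    by (simp add: jordan2_def)
  also have "(real p ^ Suc k * real d) ^ 2 = (real p ^ 2) ^ k * real p ^ 2 * real d ^ 2"
    by (simp add: power_mult_distrib power_mult[symmetric] mult.commute power2_eq_square)
  also have "\<dots> * ((1 - 1 / real p ^ 2) * (\<Prod>r\<in>prime_factors d. 1 - 1 / real r ^ 2))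
      = (real p ^ 2) ^ k * (real p ^ 2 * (1 - 1 / real p ^ 2)) * jordan2 d"
    by (simp add: jordan2_def)
  also have "real p ^ 2 * (1 - 1 / real p ^ 2) = real p ^ 2 - 1"
    using p by (simp add: field_simps)
  finally show ?thesis .
qed

lemma divisors_prime_power_Suc_mult:
  fixes p m k :: nat
  assumes "prime p" "m > 0"
  shows "{d. d dvd p ^ Suc k * m} = {d. d dvd p ^ k * m} \<union> (\<lambda>d. p ^ Suc k * d) ` {d. d dvd m}"
proof (intro equalityI subsetI)
  fix d
  assume "d \<in> {d. d dvd p ^ Suc k * m}"
  hence d: "d dvd p ^ Suc k * m" by simp
  hence d0: "d \<noteq> 0"
    using assms by (auto intro!: Nat.gr0I)
  show "d \<in> {d. d dvd p ^ k * m} \<union> (\<lambda>d. p ^ Suc k * d) ` {d. d dvd m}"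
  proof (cases "p ^ Suc k dvd d")
    case True
    then obtain e where e: "d = p ^ Suc k * e"
      by (auto elim: dvdE)
    hence "e dvd m"
      using d assms by (simp add: prime_gt_0_nat)
    thus ?thesis
      using e by blast
  next
    case False
    have "\<not> is_unit p"
      using assms(1) by auto
    from multiplicity_decompose'[OF d0 this]
    obtain e where e: "d = p ^ multiplicity p d * e" "\<not> p dvd e" .
    have "multiplicity p d \<le> k"
      using False multiplicity_dvd'[of "Suc k" p d] by (meson not_less_eq_eq)
    hence 1: "p ^ multiplicity p d dvd p ^ k"
      by (rule le_imp_power_dvd)
    have "coprime e (p ^ Suc k)"
      using e(2) assms(1) by (metis prime_imp_coprime coprime_commute coprime_power_right_iff)
    moreover have "e dvd p ^ Suc k * m"
      using d e(1) by (metis dvd_mult_right)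
    ultimately have "e dvd m"
      by (simp add: coprime_dvd_mult_right_iff)
    hence "d dvd p ^ k * m"
      using 1 e(1) by (metis mult_dvd_mono)
    thus ?thesis
      by simp
  qed
next
  fix d
  assume "d \<in> {d. d dvd p ^ k * m} \<union> (\<lambda>d. p ^ Suc k * d) ` {d. d dvd m}"
  thus "d \<in> {d. d dvd p ^ Suc k * m}"
    by (auto intro: mult_dvd_mono simp: mult.assoc)
qed

text \<open>
  Going from \<open>p ^ k * m\<close> to \<open>p ^ Suc k * m\<close>, the new divisors are those with full \<open>p\<close>-part. They
  contribute \<open>p ^ (2 * k) * (p\<^sup>2 - 1)\<close> times the sum for \<open>m\<close>, exactly the increment from
  \<open>p ^ (2 * k)\<close> to \<open>p ^ (2 * k + 2)\<close>.
\<close>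
lemma sum_jordan2_prime_power_mult:
  fixes p m k :: nat
  assumes "prime p" "\<not> p dvd m"
  shows "(\<Sum>d | d dvd p ^ k * m. jordan2 d) = (real p ^ 2) ^ k * (\<Sum>d | d dvd m. jordan2 d)"
proof (induction k)
  case (Suc k)
  have m: "m > 0"
    using assms(2) by (auto intro: Nat.gr0I)
  have p: "p > 0"
    using assms(1) by (rule prime_gt_0_nat)
  have disj: "{d. d dvd p ^ k * m} \<inter> (\<lambda>d. p ^ Suc k * d) ` {d. d dvd m} = {}"
  proof -
    have False if "p ^ Suc k * e dvd p ^ k * m" for e
    proof -
      have "p ^ k * (p * e) dvd p ^ k * m"
        using that by (simp add: mult_ac)
      hence "p * e dvd m"
        using p by simp
      with assms(2) show False
        using dvd_mult_left by blast
    qed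
    thus ?thesis
      by blast
  qed
  have "(\<Sum>d | d dvd p ^ Suc k * m. jordan2 d) = (\<Sum>d | d dvd p ^ k * m. jordan2 d)
      + (\<Sum>d\<in>(\<lambda>d. p ^ Suc k * d) ` {d. d dvd m}. jordan2 d)"
    unfolding divisors_prime_power_Suc_mult[OF assms(1) m]
    using m p disj by (intro sum.union_disjoint) auto
  also have "(\<Sum>d\<in>(\<lambda>d. p ^ Suc k * d) ` {d. d dvd m}. jordan2 d)
      = (\<Sum>d | d dvd m. jordan2 (p ^ Suc k * d))"
    using p by (subst sum.reindex) (auto simp: inj_on_def)
  also have "\<dots> = (\<Sum>d | d dvd m. (real p ^ 2) ^ k * (real p ^ 2 - 1) * jordan2 d)"
    using assms by (intro sum.cong refl jordan2_prime_power_mult) (auto dest: dvd_trans)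
  also have "\<dots> = (real p ^ 2) ^ k * (real p ^ 2 - 1) * (\<Sum>d | d dvd m. jordan2 d)"
    by (rule sum_distrib_left[symmetric])
  finally show ?case
    unfolding Suc.IH by (simp add: algebra_simps)
qed simp

lemma sum_jordan2_divisors:
  fixes m :: nat
  assumes "m > 0"
  shows "(\<Sum>d | d dvd m. jordan2 d) = real m ^ 2"
  using assms
proof (induction m rule: less_induct)
  case (less m)
  show ?case
  proof (cases "m = 1")
    case True
    thus ?thesis
      by (simp add: jordan2_def)
  next
    case False
    then obtain p where p: "prime p" "p dvd m"
      using prime_factor_nat by blast
    have "m \<noteq> 0" "\<not> is_unit p"
      using less.prems p by auto
    from multiplicity_decompose'[OF this]
    obtain m' where m': "m = p ^ multiplicity p m * m'" "\<not> p dvd m'" .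
    define k where "k = multiplicity p m"
    have m_eq: "m = p ^ k * m'"
      using m' by (simp add: k_def)
    have "k > 0"
      using p \<open>m \<noteq> 0\<close> by (simp add: k_def prime_multiplicity_gt_zero_iff)
    hence "p ^ k > 1"
      using p(1) prime_gt_1_nat by (intro one_less_power) blast+
    moreover have "m' > 0"
      using m'(2) by (auto intro: Nat.gr0I)
    ultimately have "m' < m"
      by (simp add: m_eq)
    with less.IH \<open>m' > 0\<close> have "(\<Sum>d | d dvd m'. jordan2 d) = real m' ^ 2"
      by blast
    thus ?thesis
      unfolding m_eq
      unfolding sum_jordan2_prime_power_mult[OF p(1) m'(2)]
      by (simp add: power_mult_distrib power_mult[symmetric] mult.commute)
  qed
qed

theorem sum_gcd_square_totatives:
  fixes n :: nat
  assumes "n > 1"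
  shows "(\<Sum>a\<in>totatives n. real (gcd (a - 1) n) ^ 2)
           = real (totient n) * (\<Sum>d | d dvd n. dedekind_psi d)"
proof -
  have "(\<Sum>a\<in>totatives n. real (gcd (a - 1) n) ^ 2)
      = (\<Sum>a\<in>totatives n. \<Sum>d | d dvd gcd (a - 1) n. jordan2 d)"
    using assms by (intro sum.cong refl sum_jordan2_divisors[symmetric]) auto
  also have "\<dots> = real (totient n) * (\<Sum>d | d dvd n. jordan2 d / real (totient d))"
    by (rule menon_sum[OF assms])
  also have "(\<Sum>d | d dvd n. jordan2 d / real (totient d)) = (\<Sum>d | d dvd n. dedekind_psi d)"
  proof (intro sum.cong refl)
    fix d
    assume "d \<in> {d. d dvd n}"
    hence "totient d \<noteq> 0"
      using assms dvd_pos_nat[of n d] by simp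
    thus "jordan2 d / real (totient d) = dedekind_psi d"
      by (simp add: jordan2_eq_psi_mult_totient)
  qed
  finally show ?thesis .
qed

section \<open>Bounds for Dedekind's psi function\<close>

lemma dedekind_psi_ge: "real n \<le> dedekind_psi n"
proof -
  have "1 \<le> (\<Prod>r\<in>prime_factors n. 1 + 1 / real r)"
    by (intro prod_ge_1) auto
  hence "real n * 1 \<le> dedekind_psi n"
    unfolding dedekind_psi_def by (intro mult_left_mono) auto
  thus ?thesis
    by simp
qed

lemma prod_one_plus_inverse_telescope:
  fixes p q :: nat
  assumes "0 < q" "q \<le> p"
  shows "(\<Prod>k=q..p. 1 + 1 / real k) = (real p + 1) / real q"
  using assms(2)
proof (induction p rule: dec_induct)
  case base
  thus ?case
    using assms(1) by (simp add: field_simps)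
next
  case (step m)
  thus ?case
    using assms(1) by (simp add: field_simps)
qed

lemma dedekind_psi_le:
  fixes n p q :: nat
  assumes "0 < q" "q \<le> p" "prime_factors n \<subseteq> {q..p}"
  shows "dedekind_psi n \<le> real n * ((real p + 1) / real q)"
proof -
  have "(\<Prod>r\<in>prime_factors n. 1 + 1 / real r) \<le> (\<Prod>r=q..p. 1 + 1 / real r)"
    using assms by (intro prod_mono2) auto
  thus ?thesis
    unfolding dedekind_psi_def prod_one_plus_inverse_telescope[OF assms(1,2)]
    by (intro mult_left_mono) auto
qed

theorem corollary3:
  fixes n p q :: nat
  assumes "n \<ge> 2"
    and "q = Min {r. prime r \<and> r dvd n}"
    and "p = Max {r. prime r \<and> r dvd n}"
  shows "real q / (real p + 1) * (1 / real (totient n)) * (\<Sum>a\<in>totatives n. real (gcd (a - 1) n) ^ 2)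
           \<le> real (divisor_sum n)
       \<and> real (divisor_sum n)
           \<le> 1 / real (totient n) * (\<Sum>a\<in>totatives n. real (gcd (a - 1) n) ^ 2)"
proof -
  define P where "P = {r. prime r \<and> r dvd n}"
  define \<Psi> where "\<Psi> = (\<Sum>d | d dvd n. dedekind_psi d)"
  have P: "finite P" "P \<noteq> {}"
    using assms(1) prime_factor_nat[of n] finite_subset[of P "{d. d dvd n}"]
    by (auto simp: P_def)
  have q: "q \<in> P" and p: "p \<in> P" and range: "P \<subseteq> {q..p}"
    using assms(2,3) P by (auto simp flip: P_def)
  have "q > 0"
    using q by (simp add: P_def prime_gt_0_nat)
  have "q \<le> p"
    using q range by auto
  have avg: "1 / real (totient n) * (\<Sum>a\<in>totatives n. real (gcd (a - 1) n) ^ 2) = \<Psi>"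
    using assms(1) sum_gcd_square_totatives[of n] by (simp add: \<Psi>_def)
  have "real (divisor_sum n) \<le> \<Psi>"
    unfolding divisor_sum_def \<Psi>_def of_nat_sum by (intro sum_mono dedekind_psi_ge)
  moreover have "\<Psi> \<le> (\<Sum>d | d dvd n. real d * ((real p + 1) / real q))"
    unfolding \<Psi>_def
  proof (intro sum_mono dedekind_psi_le)
    fix d
    assume "d \<in> {d. d dvd n}"
    hence "prime_factors d \<subseteq> P"
      by (auto simp: P_def intro: dvd_trans)
    with range show "prime_factors d \<subseteq> {q..p}"
      by blast
  qed (use \<open>q > 0\<close> \<open>q \<le> p\<close> in auto)
  hence "\<Psi> \<le> real (divisor_sum n) * ((real p + 1) / real q)"
    unfolding divisor_sum_def of_nat_sum sum_distrib_right .
  hence "real q / (real p + 1) * \<Psi> \<le> real (divisor_sum n)"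
    using \<open>q > 0\<close> by (simp add: field_simps)
  ultimately show ?thesis
    unfolding avg[symmetric] by (simp add: mult.assoc)
qed

end
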